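(* Let $u, v \ge 1$ be integers. A general binary form $p \in H_{uv}(\mathbb{C}^2)$ can be written as a sum of $\lceil \frac{uv+1}{u+1}\rceil$ $v$-th powers of binary forms of degree $u$. That is, $p = \sum_{i=1}^{N} f_i^v$ with $N = \lceil \frac{uv+1}{u+1}\rceil$ and each $f_i \in H_u(\mathbb{C}^2)$.
   Context: $H_d(\mathbb{C}^n)$ denotes the complex vector space of homogeneous polynomials of degree $d$ in $n$ variables. "A general $p$ has property P" means P holds for all $p$ in a nonempty Zariski-open subset of $H_d(\mathbb{C}^n)$. *)

theory Defs
  imports Complex_Main
begin

definition cspace :: "nat \<Rightarrow> (nat \<Rightarrow> complex) set" where
  "cspace n = {x. \<forall>i\<ge>n. x i = 0}"

definition polyfun :: "nat \<Rightarrow> ((nat \<Rightarrow> complex) \<Rightarrow> complex) \<Rightarrow> bool" where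
  "polyfun n g \<longleftrightarrow> (\<exists>E :: (nat \<Rightarrow> nat) set. \<exists>a :: (nat \<Rightarrow> nat) \<Rightarrow> complex. finite E \<and>
      (\<forall>x. g x = (\<Sum>e\<in>E. a e * (\<Prod>i<n. x i ^ e i))))"

definition zariski_open :: "nat \<Rightarrow> (nat \<Rightarrow> complex) set \<Rightarrow> bool" where
  "zariski_open n U \<longleftrightarrow> (\<exists>G. (\<forall>g\<in>G. polyfun n g) \<and>
      U = {x \<in> cspace n. \<exists>g\<in>G. g x \<noteq> 0})"

text \<open>H_d(C^2): a binary form of degree d is given by its coefficient vector
  c \<in> cspace (d+1), representing (x,y) \<mapsto> \<Sum>_{k\<le>d} c_k x^k y^(d-k).\<close>
definition bform :: "nat \<Rightarrow> (nat \<Rightarrow> complex) \<Rightarrow> complex \<Rightarrow> complex \<Rightarrow> complex" where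
  "bform d c x y = (\<Sum>k\<le>d. c k * x ^ k * y ^ (d - k))"

end

theory Submission
  imports Defs "HOL-Computational_Algebra.Fundamental_Theorem_Algebra"
begin

text \<open>The image of the polynomial map \<open>(f\<^sub>1, \<dots>, f\<^sub>N) \<mapsto> \<Sum> f\<^sub>i\<^sup>v\<close> is constructible, by elimination of
  quantifiers over the complex numbers, so either it or its complement contains a nonempty
  Zariski open set.  The second alternative would give a nonzero polynomial \<open>g\<close> vanishing on the image.
  The derivative of the map at \<open>f\<^sub>i = (x - i y)\<^sup>u\<close> is onto, because the forms divisible by
  \<open>(x - i y)\<^sup>u\<^sup>(\<^sup>v\<^sup>-\<^sup>1\<^sup>)\<close> for some \<open>i\<close> span the forms of degree \<open>uv\<close> as soon as \<open>N(u + 1) > uv\<close>.  Hence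
  the lowest homogeneous part of \<open>g\<close> around the image of that point vanishes everywhere,
  which is impossible.\<close>

section \<open>Polynomial functions and constructible sets\<close>

lemma polyfun_monomial: "polyfun n (\<lambda>x. a * (\<Prod>i<n. x i ^ e i))"
  unfolding polyfun_def by (intro exI[of _ "{e}"] exI[of _ "\<lambda>_. a"]) auto

lemma polyfun_const [intro]: "polyfun n (\<lambda>x. a)"
  using polyfun_monomial[of n a "\<lambda>_. 0"] by simp

lemma polyfun_coord:
  assumes "i < n" shows "polyfun n (\<lambda>x. x i)"
proof -
  have "(\<Prod>k<n. x k ^ (if k = i then 1 else 0)) = x i" for x :: "nat \<Rightarrow> complex"
    using assms by (subst prod.remove[of _ i]) (auto intro!: prod.neutral)
  then show ?thesis
    using polyfun_monomial[of n 1 "\<lambda>k. if k = i then 1 else 0"] by simp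
qed

lemma polyfun_add [intro]:
  assumes "polyfun n f" "polyfun n g" shows "polyfun n (\<lambda>x. f x + g x)"
proof -
  obtain E a where E: "finite E" "\<And>x. f x = (\<Sum>e\<in>E. a e * (\<Prod>i<n. x i ^ e i))"
    using assms(1) unfolding polyfun_def by blast
  obtain E' a' where E': "finite E'" "\<And>x. g x = (\<Sum>e\<in>E'. a' e * (\<Prod>i<n. x i ^ e i))"
    using assms(2) unfolding polyfun_def by blast
  define b where "b e = (if e \<in> E then a e else 0) + (if e \<in> E' then a' e else 0)" for e
  have "f x + g x = (\<Sum>e\<in>E \<union> E'. b e * (\<Prod>i<n. x i ^ e i))" for x
  proof -
    have "f x = (\<Sum>e\<in>E \<union> E'. (if e \<in> E then a e else 0) * (\<Prod>i<n. x i ^ e i))"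
      unfolding E(2) using E(1) E'(1) by (intro sum.mono_neutral_cong_left) auto
    moreover have "g x = (\<Sum>e\<in>E \<union> E'. (if e \<in> E' then a' e else 0) * (\<Prod>i<n. x i ^ e i))"
      unfolding E'(2) using E(1) E'(1) by (intro sum.mono_neutral_cong_left) auto
    ultimately show ?thesis
      by (simp add: b_def distrib_right sum.distrib)
  qed
  then show ?thesis
    unfolding polyfun_def using E(1) E'(1) by (intro exI[of _ "E \<union> E'"] exI[of _ b]) auto
qed

lemma polyfun_sum [intro]:
  "(\<And>s. s \<in> S \<Longrightarrow> polyfun n (f s)) \<Longrightarrow> polyfun n (\<lambda>x. \<Sum>s\<in>S. f s x)"
  by (induction S rule: infinite_finite_induct) auto

lemma polyfun_mult [intro]:
  assumes "polyfun n f" "polyfun n g" shows "polyfun n (\<lambda>x. f x * g x)"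
proof -
  obtain E a where E: "finite E" "\<And>x. f x = (\<Sum>e\<in>E. a e * (\<Prod>i<n. x i ^ e i))"
    using assms(1) unfolding polyfun_def by blast
  obtain E' a' where E': "finite E'" "\<And>x. g x = (\<Sum>e\<in>E'. a' e * (\<Prod>i<n. x i ^ e i))"
    using assms(2) unfolding polyfun_def by blast
  have "f x * g x = (\<Sum>e\<in>E. \<Sum>e'\<in>E'. (a e * a' e') * (\<Prod>i<n. x i ^ (e i + e' i)))" for x
    by (simp add: E(2) E'(2) sum_product power_add prod.distrib mult.assoc mult.left_commute)
  then show ?thesis
    by (simp only:) (intro polyfun_sum polyfun_monomial)
qed

lemma polyfun_diff [intro]:
  assumes "polyfun n f" "polyfun n g" shows "polyfun n (\<lambda>x. f x - g x)"
  using polyfun_add[OF assms(1) polyfun_mult[OF polyfun_const[of n "-1"] assms(2)]] by simp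

lemma polyfun_power [intro]: "polyfun n f \<Longrightarrow> polyfun n (\<lambda>x. f x ^ k)"
  by (induction k) auto

lemma polyfun_prod [intro]:
  "(\<And>s. s \<in> S \<Longrightarrow> polyfun n (f s)) \<Longrightarrow> polyfun n (\<lambda>x. \<Prod>s\<in>S. f s x)"
  by (induction S rule: infinite_finite_induct) auto

lemma polyfun_subst:
  assumes "polyfun n g" "\<And>i. i < n \<Longrightarrow> polyfun m (\<phi> i)"
  shows "polyfun m (\<lambda>x. g (\<lambda>i. \<phi> i x))"
proof -
  obtain E a where E: "\<And>x. g x = (\<Sum>e\<in>E. a e * (\<Prod>i<n. x i ^ e i))"
    using assms(1) unfolding polyfun_def by blast
  show ?thesis
    unfolding E using assms(2) by (intro polyfun_sum polyfun_mult polyfun_const polyfun_prod polyfun_power) auto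
qed

lemma polyfun_cong:
  assumes "polyfun n g" "\<And>i. i < n \<Longrightarrow> x i = y i" shows "g x = g y"
proof -
  obtain E a where "\<And>x. g x = (\<Sum>e\<in>E. a e * (\<Prod>i<n. x i ^ e i))"
    using assms(1) unfolding polyfun_def by blast
  then show ?thesis using assms(2) by simp
qed

lemma polyfun_along_line:
  assumes "polyfun n g" shows "\<exists>p. \<forall>t. g (\<lambda>i. a i + t * b i) = poly p t"
proof -
  obtain E c where E: "\<And>x. g x = (\<Sum>e\<in>E. c e * (\<Prod>i<n. x i ^ e i))"
    using assms unfolding polyfun_def by blast
  have "g (\<lambda>i. a i + t * b i) = poly (\<Sum>e\<in>E. [:c e:] * (\<Prod>i<n. [:a i, b i:] ^ e i)) t" for t
    unfolding E by (simp add: poly_sum poly_prod)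
  then show ?thesis by blast
qed

text \<open>On the line through \<open>a\<close> and \<open>b\<close> both factors become nonzero
  polynomials in one variable, the first by its value at 0, the second by its value at 1, and a
  product of such polynomials has a non-root.\<close>

lemma polyfun_mult_nonzero:
  assumes "polyfun n f" "polyfun n g" "f a \<noteq> 0" "g b \<noteq> 0"
  shows "\<exists>x. f x * g x \<noteq> 0"
proof -
  obtain p where "\<forall>t. f (\<lambda>i. a i + t * (b i - a i)) = poly p t"
    using polyfun_along_line[OF assms(1), of a "\<lambda>i. b i - a i"] by (rule exE)
  note p = this[rule_format]
  obtain q where "\<forall>t. g (\<lambda>i. a i + t * (b i - a i)) = poly q t"
    using polyfun_along_line[OF assms(2), of a "\<lambda>i. b i - a i"] by (rule exE)
  note q = this[rule_format]
  have "p \<noteq> 0" using p[of 0] assms(3) by (intro notI) simp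
  moreover have "q \<noteq> 0" using q[of 1] assms(4) by (intro notI) simp
  ultimately have "p * q \<noteq> 0" by simp
  then obtain t where "poly (p * q) t \<noteq> 0"
    using poly_all_0_iff_0[of "p * q"] by blast
  then show ?thesis
    unfolding poly_mult p[symmetric] q[symmetric] by blast
qed

section \<open>Constructible sets and their generic behaviour\<close>

inductive constructible :: "nat \<Rightarrow> (nat \<Rightarrow> complex) set \<Rightarrow> bool" for n where
  zeros: "polyfun n f \<Longrightarrow> constructible n {x. f x = 0}"
| compl: "constructible n S \<Longrightarrow> constructible n (- S)"
| inter: "constructible n S \<Longrightarrow> constructible n T \<Longrightarrow> constructible n (S \<inter> T)"

lemma constructible_union: "constructible n S \<Longrightarrow> constructible n T \<Longrightarrow> constructible n (S \<union> T)"
  using compl[OF inter[OF compl compl, of n S T]] by simp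

lemma constructible_UNIV: "constructible n UNIV"
  using zeros[OF polyfun_const[of n 0]] by simp

lemma constructible_nonzeros: "polyfun n f \<Longrightarrow> constructible n {x. f x \<noteq> 0}"
  using compl[OF zeros, of n f] by (simp add: Collect_neg_eq)

lemma constructible_Ball:
  "finite A \<Longrightarrow> (\<And>k. k \<in> A \<Longrightarrow> constructible n {x. P k x}) \<Longrightarrow> constructible n {x. \<forall>k\<in>A. P k x}"
proof (induction A rule: finite_induct)
  case (insert a A)
  have "{x. \<forall>k\<in>insert a A. P k x} = {x. P a x} \<inter> {x. \<forall>k\<in>A. P k x}" by auto
  with insert show ?case by (auto intro: inter)
qed (simp add: constructible_UNIV)

text \<open>Lets an elimination step branch on whether a leading coefficient vanishes, with a
  different description of the set on each branch.\<close>

lemma constructible_split: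
  assumes "polyfun n c" "constructible n A" "constructible n B"
    "\<And>x. c x = 0 \<Longrightarrow> x \<in> S \<longleftrightarrow> x \<in> A" "\<And>x. c x \<noteq> 0 \<Longrightarrow> x \<in> S \<longleftrightarrow> x \<in> B"
  shows "constructible n S"
proof -
  have "S = ({x. c x = 0} \<inter> A) \<union> ({x. c x \<noteq> 0} \<inter> B)"
    using assms(4,5) by blast
  then show ?thesis
    using assms(1-3) by (simp add: constructible_union inter zeros constructible_nonzeros)
qed

text \<open>Passing to the complement swaps the two alternatives. For an intersection the product of
  the two witnesses works: where it is nonzero, either both memberships hold throughout or one of
  them fails throughout.\<close>

lemma constructible_generic_dichotomy:
  assumes "constructible n S"
  shows "\<exists>g. polyfun n g \<and> (\<exists>a. g a \<noteq> 0) \<and>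
    ((\<forall>x. g x \<noteq> 0 \<longrightarrow> x \<in> S) \<or> (\<forall>x. g x \<noteq> 0 \<longrightarrow> x \<notin> S))"
  using assms
proof (induction)
  case (zeros f)
  show ?case
  proof (cases "\<exists>a. f a \<noteq> 0")
    case True then show ?thesis using zeros by (intro exI[of _ f]) simp
  next
    case False then show ?thesis by (intro exI[of _ "\<lambda>_. 1"]) auto
  qed
next
  case (compl S) then show ?case by (simp add: disj_commute)
next
  case (inter S T)
  obtain g a where g: "polyfun n g" "g a \<noteq> 0"
      "(\<forall>x. g x \<noteq> 0 \<longrightarrow> x \<in> S) \<or> (\<forall>x. g x \<noteq> 0 \<longrightarrow> x \<notin> S)"
    using inter.IH(1) by (elim exE conjE) (rule that)
  obtain h b where h: "polyfun n h" "h b \<noteq> 0"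
      "(\<forall>x. h x \<noteq> 0 \<longrightarrow> x \<in> T) \<or> (\<forall>x. h x \<noteq> 0 \<longrightarrow> x \<notin> T)"
    using inter.IH(2) by (elim exE conjE) (rule that)
  have "\<exists>a. g a * h a \<noteq> 0" using polyfun_mult_nonzero[OF g(1) h(1) g(2) h(2)] .
  moreover have "(\<forall>x. g x * h x \<noteq> 0 \<longrightarrow> x \<in> S \<inter> T) \<or> (\<forall>x. g x * h x \<noteq> 0 \<longrightarrow> x \<notin> S \<inter> T)"
    using g(3) h(3) by auto
  ultimately show ?case using polyfun_mult[OF g(1) h(1)]
    by (intro exI[of _ "\<lambda>x. g x * h x"] conjI)
qed

section \<open>Polynomials in one variable with coefficients depending on parameters\<close>

definition param_poly :: "nat \<Rightarrow> nat \<Rightarrow> ((nat \<Rightarrow> complex) \<Rightarrow> complex poly) \<Rightarrow> bool" where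
  "param_poly n d P \<longleftrightarrow> (\<forall>k. polyfun n (\<lambda>x. coeff (P x) k)) \<and> (\<forall>x. degree (P x) \<le> d)"

lemma param_poly_coeff: "param_poly n d P \<Longrightarrow> polyfun n (\<lambda>x. coeff (P x) k)"
  by (simp add: param_poly_def)

lemma param_poly_degree: "param_poly n d P \<Longrightarrow> degree (P x) \<le> d"
  by (simp add: param_poly_def)

lemma param_poly_monom:
  assumes "polyfun n c" "k \<le> d" shows "param_poly n d (\<lambda>x. monom (c x) k)"
  unfolding param_poly_def
proof (intro conjI allI)
  show "polyfun n (\<lambda>x. coeff (monom (c x) k) j)" for j
    using assms(1) by (cases "k = j") auto
  show "degree (monom (c x) k) \<le> d" for x
    using degree_monom_le[of "c x" k] assms(2) by linarith
qed

lemma param_poly_const: "degree p \<le> d \<Longrightarrow> param_poly n d (\<lambda>x. p)"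
  unfolding param_poly_def by auto

lemma param_poly_diff:
  "param_poly n d P \<Longrightarrow> param_poly n d Q \<Longrightarrow> param_poly n d (\<lambda>x. P x - Q x)"
  unfolding param_poly_def by (auto intro: degree_diff_le)

lemma param_poly_sum:
  "(\<And>s. s \<in> S \<Longrightarrow> param_poly n d (P s)) \<Longrightarrow> param_poly n d (\<lambda>x. \<Sum>s\<in>S. P s x)"
  unfolding param_poly_def
  by (cases "finite S") (auto simp: coeff_sum intro!: degree_sum_le)

lemma param_poly_mult:
  assumes "param_poly n d P" "param_poly n e Q"
  shows "param_poly n (d + e) (\<lambda>x. P x * Q x)"
  unfolding param_poly_def
proof (intro conjI allI)
  show "polyfun n (\<lambda>x. coeff (P x * Q x) k)" for k
    unfolding coeff_mult
    by (intro polyfun_sum polyfun_mult param_poly_coeff[OF assms(1)] param_poly_coeff[OF assms(2)])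
  show "degree (P x * Q x) \<le> d + e" for x
    using degree_mult_le[of "P x" "Q x"] param_poly_degree[OF assms(1), of x]
      param_poly_degree[OF assms(2), of x] by linarith
qed

lemma param_poly_smult:
  "polyfun n c \<Longrightarrow> param_poly n d P \<Longrightarrow> param_poly n d (\<lambda>x. smult (c x) (P x))"
  unfolding param_poly_def by (auto intro: order.trans[OF degree_smult_le])

lemma param_poly_power: "param_poly n d P \<Longrightarrow> param_poly n (d * k) (\<lambda>x. P x ^ k)"
proof (induction k)
  case 0 then show ?case using param_poly_const[of 1 0] by simp
next
  case (Suc k) then show ?case using param_poly_mult[of n d P "d * k" "\<lambda>x. P x ^ k"] by simp
qed

text \<open>The actual degree varies with the parameter, so elimination works with a uniform bound;
  it may be lowered once the coefficient at the bound vanishes identically.\<close>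

lemma param_poly_lower:
  assumes "param_poly n (Suc d) P" "\<And>x. coeff (P x) (Suc d) = 0"
  shows "param_poly n d P"
proof -
  have "degree (P x) \<le> d" for x
    using assms by (metis param_poly_degree le_SucE leading_coeff_0_iff degree_0 le0)
  then show ?thesis using assms unfolding param_poly_def by auto
qed

lemma polyfun_Suc_param_poly:
  assumes "polyfun (Suc n) g"
  shows "\<exists>d P. param_poly n d P \<and> (\<forall>x t. g (x(n := t)) = poly (P x) t)"
proof -
  obtain E a where E: "finite E" "\<And>x. g x = (\<Sum>e\<in>E. a e * (\<Prod>i<Suc n. x i ^ e i))"
    using assms unfolding polyfun_def by blast
  define d where "d = (\<Sum>e\<in>E. e n)"
  have "param_poly n d (\<lambda>x. \<Sum>e\<in>E. monom (a e * (\<Prod>i<n. x i ^ e i)) (e n))"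
    using E(1) by (intro param_poly_sum param_poly_monom polyfun_monomial) (auto simp: d_def intro!: member_le_sum)
  moreover have "g (x(n := t)) = poly (\<Sum>e\<in>E. monom (a e * (\<Prod>i<n. x i ^ e i)) (e n)) t" for x t
    by (simp add: E(2) poly_sum poly_monom mult_ac)
  ultimately show ?thesis by blast
qed

section \<open>Elimination of one variable\<close>

lemma param_poly_diff_monom_lower:
  assumes "param_poly n (Suc d) P" "param_poly n (Suc d) Q" "\<And>x. coeff (P x) (Suc d) = coeff (Q x) (Suc d)"
  shows "param_poly n d (\<lambda>x. P x - Q x)"
  by (rule param_poly_lower[OF param_poly_diff[OF assms(1,2)]]) (simp add: assms(3))

lemma dvd_diff_mult_iff_smult:
  fixes p q r :: "complex poly"
  assumes "c \<noteq> 0"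
  shows "p dvd smult c q - r * p \<longleftrightarrow> p dvd q"
  using assms dvd_diff_left_iff[of p "r * p" "smult c q"] by (simp add: dvd_smult_iff)

text \<open>Pseudo-division of \<open>H\<close> by \<open>P\<close>, by induction on the degree bound of \<open>H\<close>.\<close>
lemma constructible_dvd:
  assumes "param_poly n d P" "param_poly n e H"
  shows "\<exists>A. constructible n A \<and> (\<forall>x. coeff (P x) d \<noteq> 0 \<longrightarrow> (x \<in> A \<longleftrightarrow> P x dvd H x))"
  using assms(2)
proof (induction e arbitrary: H)
  case 0
  show ?case
  proof (cases "d = 0")
    case True
    have "P x dvd H x" if "coeff (P x) d \<noteq> 0" for x
    proof -
      have "is_unit (P x)" using that True param_poly_degree[OF assms(1), of x]
        by (subst is_unit_iff_degree) auto
      then show ?thesis by blast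
    qed
    then show ?thesis using constructible_UNIV by blast
  next
    case False
    have "P x dvd H x \<longleftrightarrow> coeff (H x) 0 = 0" if "coeff (P x) d \<noteq> 0" for x
    proof -
      have "degree (H x) = 0" using param_poly_degree[OF 0, of x] by simp
      moreover have "degree (P x) \<noteq> 0" using le_degree[OF that] False by simp
      ultimately show ?thesis
        by (metis degree_0 dvd_0_right dvd_imp_degree_le le_zero_eq leading_coeff_0_iff)
    qed
    then show ?thesis using zeros[OF param_poly_coeff[OF 0, of 0]] by blast
  qed
next
  case (Suc e)
  show ?case
  proof (cases "d \<le> Suc e")
    case True
    \<comment> \<open>Multiplying \<open>H\<close> by the top coefficient of \<open>P\<close>,
      instead of dividing by it, keeps the coefficients polynomial in the parameters; the terms of
      degree \<open>Suc e\<close> cancel.\<close>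
    define H' where "H' x = smult (coeff (P x) d) (H x) - monom (coeff (H x) (Suc e)) (Suc e - d) * P x" for x
    have "param_poly n (Suc e - d + d) (\<lambda>x. monom (coeff (H x) (Suc e)) (Suc e - d) * P x)"
      by (intro param_poly_mult param_poly_monom param_poly_coeff[OF Suc.prems] assms(1)) auto
    then have "param_poly n e H'"
      unfolding H'_def using True
      by (intro param_poly_diff_monom_lower param_poly_smult param_poly_coeff[OF assms(1)] Suc.prems)
        (auto simp: coeff_monom_mult)
    then obtain A where "constructible n A"
        "\<forall>x. coeff (P x) d \<noteq> 0 \<longrightarrow> (x \<in> A \<longleftrightarrow> P x dvd H' x)"
      using Suc.IH by blast
    then show ?thesis by (auto simp: H'_def dvd_diff_mult_iff_smult)
  next
    case False
    have "P x dvd H x \<longleftrightarrow> (\<forall>k\<in>{..Suc e}. coeff (H x) k = 0)" if "coeff (P x) d \<noteq> 0" for x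
    proof -
      have "degree (H x) < degree (P x)"
        using param_poly_degree[OF Suc.prems, of x] le_degree[OF that] False by simp
      then have "P x dvd H x \<longleftrightarrow> H x = 0" by (metis dvd_0_right dvd_imp_degree_le not_le)
      also have "\<dots> \<longleftrightarrow> (\<forall>k\<in>{..Suc e}. coeff (H x) k = 0)"
        using param_poly_degree[OF Suc.prems, of x] by (metis atMost_iff coeff_0 leading_coeff_0_iff)
      finally show ?thesis .
    qed
    moreover have "constructible n {x. \<forall>k\<in>{..Suc e}. coeff (H x) k = 0}"
      by (intro constructible_Ball zeros param_poly_coeff[OF Suc.prems]) auto
    ultimately show ?thesis by blast
  qed
qed

text \<open>The pairs \<open>(d, P)\<close> carry a degree bound, and each case distinction lowers the sum of the
  bounds: either a bound is not attained, or it is attained by a \<open>P\<close> of least bound, which then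
  reduces any other equation.  A single equation of known degree is decided by the
  Nullstellensatz in one variable.\<close>
lemma constructible_common_root:
  assumes "\<And>d P. (d, P) \<in> set Ps \<Longrightarrow> param_poly n d P" "param_poly n e Q"
  shows "constructible n {x. \<exists>t. (\<forall>(d, P) \<in> set Ps. poly (P x) t = 0) \<and> poly (Q x) t \<noteq> 0}"
  using assms(1)
proof (induction "\<Sum>(d, P)\<leftarrow>Ps. Suc d" arbitrary: Ps rule: less_induct)
  case less
  define S where "S Ps = {x. \<exists>t. (\<forall>(d, P) \<in> set Ps. poly (P x) t = 0) \<and> poly (Q x) t \<noteq> 0}"
    for Ps :: "(nat \<times> ((nat \<Rightarrow> complex) \<Rightarrow> complex poly)) list"
  \<comment> \<open>Counting \<open>Suc d\<close> rather than \<open>d\<close> makes the weight drop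
    also when an equation of bound 0 is discarded.\<close>
  define w where "w Ps = (\<Sum>(d, P)\<leftarrow>Ps. Suc d)" for Ps :: "(nat \<times> ((nat \<Rightarrow> complex) \<Rightarrow> complex poly)) list"
  have IH: "constructible n (S Ps')" if "w Ps' < w Ps" "\<And>d P. (d, P) \<in> set Ps' \<Longrightarrow> param_poly n d P" for Ps'
    using less.hyps[of Ps'] that unfolding S_def w_def by blast
  have "constructible n (S Ps)"
  proof (cases "Ps = []")
    case True
    \<comment> \<open>With no equations left, a suitable \<open>t\<close> exists exactly when
      \<open>Q x\<close> is not the zero polynomial.\<close>
    have "S Ps = - {x. \<forall>k\<in>{..e}. coeff (Q x) k = 0}"
    proof -
      have "(\<exists>t. poly (Q x) t \<noteq> 0) \<longleftrightarrow> \<not> (\<forall>k\<in>{..e}. coeff (Q x) k = 0)" for x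
        using param_poly_degree[OF assms(2), of x] poly_all_0_iff_0[of "Q x"]
        by (metis atMost_iff coeff_0 leading_coeff_0_iff)
      then show ?thesis by (auto simp: S_def True)
    qed
    moreover have "constructible n {x. \<forall>k\<in>{..e}. coeff (Q x) k = 0}"
      by (intro constructible_Ball zeros param_poly_coeff[OF assms(2)]) auto
    ultimately show ?thesis by (simp add: compl)
  next
    case False
    define dP where "dP = arg_min_list fst Ps"
    obtain d P where dP: "dP = (d, P)" by fastforce
    have in_Ps: "(d, P) \<in> set Ps" using arg_min_list_in[OF False, of fst] dP dP_def by simp
    have min: "d \<le> d'" if "(d', P') \<in> set Ps" for d' P'
      using that f_arg_min_list_f[OF False, of fst] dP dP_def by (metis Min_le List.finite_set finite_imageI fst_conv image_eqI)
    obtain Ls where Ls: "mset Ps = mset ((d, P) # Ls)"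
      using in_Ps by (metis ex_mset mset.simps(2) multi_member_split set_mset_mset)
    have set_Ps: "set Ps = insert (d, P) (set Ls)"
      using mset_eq_setD[OF Ls] by simp
    have w_Ps: "w Ps = Suc d + w Ls"
    proof -
      have "sum_mset (image_mset (\<lambda>(d, P). Suc d) (mset Ps)) = sum_mset (image_mset (\<lambda>(d, P). Suc d) (mset ((d, P) # Ls)))"
        unfolding Ls ..
      then show ?thesis unfolding w_def by (simp flip: sum_mset_sum_list)
    qed
    have P: "param_poly n d P" and Ls_param: "\<And>d' P'. (d', P') \<in> set Ls \<Longrightarrow> param_poly n d' P'"
      using less.prems set_Ps by auto
    have c: "polyfun n (\<lambda>x. coeff (P x) d)" using param_poly_coeff[OF P] .
    have "\<exists>A. constructible n A \<and> (\<forall>x. coeff (P x) d = 0 \<longrightarrow> (x \<in> S Ps \<longleftrightarrow> x \<in> A))"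
    proof (cases d)
      case 0
      have "x \<in> S Ps \<longleftrightarrow> x \<in> S Ls" if "coeff (P x) d = 0" for x
      proof -
        have "P x = 0" using that 0 param_poly_degree[OF P, of x] by (metis le_zero_eq leading_coeff_0_iff)
        then show ?thesis by (auto simp: S_def set_Ps)
      qed
      moreover have "constructible n (S Ls)" using IH[of Ls] w_Ps Ls_param by simp
      ultimately show ?thesis by blast
    next
      case (Suc d')
      \<comment> \<open>On the branch where the top coefficient vanishes, removing its term changes
        nothing and lowers the bound.\<close>
      define P' where "P' x = P x - monom (coeff (P x) d) d" for x
      have "param_poly n d' P'"
        unfolding P'_def using P c by (intro param_poly_diff_monom_lower param_poly_monom) (auto simp: Suc)
      then have "constructible n (S ((d', P') # Ls))"
        using IH[of "(d', P') # Ls"] w_Ps Ls_param Suc by (auto simp: w_def)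
      moreover have "x \<in> S Ps \<longleftrightarrow> x \<in> S ((d', P') # Ls)" if "coeff (P x) d = 0" for x
        using that by (auto simp: S_def set_Ps P'_def)
      ultimately show ?thesis by blast
    qed
    moreover have "\<exists>A. constructible n A \<and> (\<forall>x. coeff (P x) d \<noteq> 0 \<longrightarrow> (x \<in> S Ps \<longleftrightarrow> x \<in> A))"
    proof (cases Ls)
      case Nil
      \<comment> \<open>On this branch \<open>P x\<close> has degree exactly \<open>d\<close>, so
        one exponent serves all parameters: the roots of \<open>P x\<close> all lie among those of
        \<open>Q x\<close> iff \<open>P x\<close> divides \<open>Q x ^ d\<close>.\<close>
      have "param_poly n (e * d) (\<lambda>x. Q x ^ d)" by (rule param_poly_power[OF assms(2)])
      then obtain A where A: "constructible n A" "\<And>x. coeff (P x) d \<noteq> 0 \<Longrightarrow> (x \<in> A \<longleftrightarrow> P x dvd Q x ^ d)"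
        using constructible_dvd[OF P] by blast
      have "x \<in> S Ps \<longleftrightarrow> x \<in> - A" if "coeff (P x) d \<noteq> 0" for x
      proof -
        have "degree (P x) = d" using le_degree[OF that] param_poly_degree[OF P, of x] by simp
        then have "x \<notin> S Ps \<longleftrightarrow> P x dvd Q x ^ d"
          using nullstellensatz_univariate[of "P x" "Q x"] that by (auto simp: S_def set_Ps Nil)
        then show ?thesis using A(2)[OF that] by auto
      qed
      then show ?thesis using compl[OF A(1)] by blast
    next
      case (Cons dR Ms)
      obtain d' R where dR: "dR = (d', R)" by fastforce
      have R: "param_poly n d' R" using Ls_param Cons dR by simp
      have "d \<le> d'" using min[of d' R] set_Ps Cons dR by simp
      \<comment> \<open>Pseudo-remainder: at a root of \<open>P x\<close> it is a nonzero multiple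
        of \<open>R x\<close>, and its coefficient at the bound \<open>d'\<close> is zero.\<close>
      define R' where "R' x = smult (coeff (P x) d) (R x) - monom (coeff (R x) d') (d' - d) * P x" for x
      have monomP: "param_poly n (d' - d + d) (\<lambda>x. monom (coeff (R x) d') (d' - d) * P x)"
        by (intro param_poly_mult param_poly_monom param_poly_coeff[OF R] P) auto
      have cR: "param_poly n d' (\<lambda>x. smult (coeff (P x) d) (R x))"
        by (intro param_poly_smult c R)
      have S_R': "x \<in> S Ps \<longleftrightarrow> (\<exists>t. poly (P x) t = 0 \<and> poly (R' x) t = 0 \<and>
          (\<forall>(d, P) \<in> set Ms. poly (P x) t = 0) \<and> poly (Q x) t \<noteq> 0)" if "coeff (P x) d \<noteq> 0" for x
      proof -
        have "poly (P x) t = 0 \<Longrightarrow> poly (R' x) t = 0 \<longleftrightarrow> poly (R x) t = 0" for t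
          using that by (simp add: R'_def)
        moreover have "x \<in> S Ps \<longleftrightarrow> (\<exists>t. poly (P x) t = 0 \<and> poly (R x) t = 0 \<and>
          (\<forall>(d, P) \<in> set Ms. poly (P x) t = 0) \<and> poly (Q x) t \<noteq> 0)"
          by (simp add: S_def set_Ps Cons dR conj_assoc)
        ultimately show ?thesis by blast
      qed
      show ?thesis
      proof (cases d')
        case 0
        have "R' x = 0" for x
          using param_poly_degree[OF R, of x] param_poly_degree[OF P, of x] \<open>d \<le> d'\<close> 0
          by (auto simp: R'_def monom_0 elim!: degree_eq_zeroE)
        then have "x \<in> S Ps \<longleftrightarrow> x \<in> S ((d, P) # Ms)" if "coeff (P x) d \<noteq> 0" for x
          using S_R'[OF that] by (auto simp: S_def)
        moreover have "constructible n (S ((d, P) # Ms))"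
          using Ls_param P by (intro IH) (auto simp: w_Ps Cons dR, auto simp: w_def)
        ultimately show ?thesis by blast
      next
        case (Suc d'')
        have "param_poly n d'' R'"
          unfolding R'_def using monomP cR \<open>d \<le> d'\<close>
          by (intro param_poly_diff_monom_lower) (auto simp: Suc coeff_monom_mult)
        then have "constructible n (S ((d, P) # (d'', R') # Ms))"
          using Ls_param P by (intro IH) (auto simp: w_Ps Cons dR Suc, auto simp: w_def)
        moreover have "x \<in> S Ps \<longleftrightarrow> x \<in> S ((d, P) # (d'', R') # Ms)" if "coeff (P x) d \<noteq> 0" for x
          using S_R'[OF that] by (auto simp: S_def)
        ultimately show ?thesis by blast
      qed
    qed
    ultimately show ?thesis using constructible_split[OF c] by metis
  qed
  then show ?case unfolding S_def .
qed

section \<open>Projections of constructible sets and images of polynomial maps\<close>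

text \<open>Finite unions of sets \<open>{f\<^sub>1 = \<dots> = f\<^sub>r = 0 \<noteq> g}\<close>, the shape for which a quantifier can be
  eliminated.\<close>
inductive constructible_dnf :: "nat \<Rightarrow> (nat \<Rightarrow> complex) set \<Rightarrow> bool" for n where
  basic: "\<forall>f \<in> set fs. polyfun n f \<Longrightarrow> polyfun n g \<Longrightarrow>
    constructible_dnf n {x. (\<forall>f \<in> set fs. f x = 0) \<and> g x \<noteq> 0}"
| union: "constructible_dnf n S \<Longrightarrow> constructible_dnf n T \<Longrightarrow> constructible_dnf n (S \<union> T)"

lemma constructible_dnf_Int_basic:
  assumes "\<forall>f \<in> set fs. polyfun n f" "polyfun n g" "constructible_dnf n T"
  shows "constructible_dnf n ({x. (\<forall>f \<in> set fs. f x = 0) \<and> g x \<noteq> 0} \<inter> T)"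
  using assms(3)
proof (induction)
  case (basic fs' g')
  have "{x. (\<forall>f \<in> set fs. f x = 0) \<and> g x \<noteq> 0} \<inter> {x. (\<forall>f \<in> set fs'. f x = 0) \<and> g' x \<noteq> 0}
      = {x. (\<forall>f \<in> set (fs @ fs'). f x = 0) \<and> g x * g' x \<noteq> 0}" by auto
  moreover have "constructible_dnf n {x. (\<forall>f \<in> set (fs @ fs'). f x = 0) \<and> g x * g' x \<noteq> 0}"
    using basic assms(1,2) by (intro constructible_dnf.basic polyfun_mult) auto
  ultimately show ?case by simp
next
  case (union S T)
  then show ?case by (simp add: Int_Un_distrib constructible_dnf.union)
qed

lemma constructible_dnf_Int:
  assumes "constructible_dnf n S" "constructible_dnf n T"
  shows "constructible_dnf n (S \<inter> T)"
  using assms(1)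
proof (induction)
  case (basic fs g)
  then show ?case using constructible_dnf_Int_basic[OF basic assms(2)] by simp
next
  case (union S S')
  then show ?case by (simp add: Int_Un_distrib2 constructible_dnf.union)
qed

text \<open>Treating the set and its complement together makes complementation a swap; the
  complement of an intersection becomes a union.\<close>

lemma constructible_imp_dnf:
  assumes "constructible n S"
  shows "constructible_dnf n S \<and> constructible_dnf n (- S)"
  using assms
proof (induction)
  case (zeros f)
  have "constructible_dnf n {x. (\<forall>f \<in> set [f]. f x = 0) \<and> (1::complex) \<noteq> 0}"
    using zeros by (intro constructible_dnf.basic) auto
  moreover have "constructible_dnf n {x. (\<forall>f \<in> set ([] :: ((nat \<Rightarrow> complex) \<Rightarrow> complex) list). f x = 0) \<and> f x \<noteq> 0}"
    using zeros by (intro constructible_dnf.basic) auto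
  ultimately show ?case by (simp add: Collect_neg_eq)
next
  case (compl S) then show ?case by simp
next
  case (inter S T) then show ?case by (simp add: constructible_dnf_Int constructible_dnf.union)
qed

text \<open>The quantifier distributes over unions, so only basic sets need elimination; their
  functions are read as polynomials in coordinate \<open>n\<close> over the earlier ones.\<close>

lemma constructible_projection:
  assumes "constructible (Suc n) S"
  shows "constructible n {x. \<exists>t. x(n := t) \<in> S}"
proof -
  have "constructible_dnf (Suc n) S" using constructible_imp_dnf[OF assms] ..
  then show ?thesis
  proof (induction)
    case (basic fs g)
    have ex_D: "\<forall>f\<in>set fs. \<exists>D. param_poly n (fst D) (snd D) \<and> (\<forall>x t. f (x(n := t)) = poly (snd D x) t)"
    proof
      fix f assume "f \<in> set fs"
      then have "polyfun (Suc n) f" using basic(1) by simp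
      from polyfun_Suc_param_poly[OF this]
      show "\<exists>D. param_poly n (fst D) (snd D) \<and> (\<forall>x t. f (x(n := t)) = poly (snd D x) t)"
        by simp
    qed
    obtain D where D: "\<forall>f\<in>set fs. param_poly n (fst (D f)) (snd (D f)) \<and>
        (\<forall>x t. f (x(n := t)) = poly (snd (D f) x) t)"
      using bchoice[OF ex_D] by (elim exE) (rule that)
    obtain e Q where Q: "param_poly n e Q" and gQ: "\<forall>x t. g (x(n := t)) = poly (Q x) t"
      using polyfun_Suc_param_poly[OF basic(2)] by (elim exE conjE) (rule that)
    have "constructible n {x. \<exists>t. (\<forall>(d, P) \<in> set (map D fs). poly (P x) t = 0) \<and> poly (Q x) t \<noteq> 0}"
      using D by (intro constructible_common_root[OF _ Q]) (metis (no_types, lifting) fst_conv snd_conv imageE list.set_map)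
    also have "{x. \<exists>t. (\<forall>(d, P) \<in> set (map D fs). poly (P x) t = 0) \<and> poly (Q x) t \<noteq> 0}
        = {x. \<exists>t. x(n := t) \<in> {x. (\<forall>f \<in> set fs. f x = 0) \<and> g x \<noteq> 0}}"
      using D by (simp add: gQ split_beta)
    finally show ?case .
  next
    case (union S T)
    have "{x. \<exists>t. x(n := t) \<in> S \<union> T} = {x. \<exists>t. x(n := t) \<in> S} \<union> {x. \<exists>t. x(n := t) \<in> T}" by blast
    then show ?case using constructible_union[OF union.IH] by (simp only:)
  qed
qed

lemma constructible_projection_iterated:
  assumes "constructible (n + m) S"
  shows "constructible n {x. \<exists>z. (\<lambda>i. if i < n then x i else z i) \<in> S}"
  using assms
proof (induction m arbitrary: S)
  case 0
  define \<pi> :: "(nat \<Rightarrow> complex) \<Rightarrow> (nat \<Rightarrow> complex) \<Rightarrow> nat \<Rightarrow> complex" where "\<pi> x z i = (if i < n then x i else z i)" for x z i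
  have "constructible n S" using 0 by simp
  then have "\<forall>x y. (\<forall>i<n. x i = y i) \<longrightarrow> (x \<in> S \<longleftrightarrow> y \<in> S)"
  proof (induction)
    case (zeros f)
    show ?case
    proof (intro allI impI)
      fix x y :: "nat \<Rightarrow> complex" assume "\<forall>i<n. x i = y i"
      then have "f x = f y" by (intro polyfun_cong[OF zeros]) simp
      then show "x \<in> {x. f x = 0} \<longleftrightarrow> y \<in> {x. f x = 0}" by simp
    qed
  qed auto
  then have "\<pi> x z \<in> S \<longleftrightarrow> x \<in> S" for x z by (simp add: \<pi>_def)
  then have "{x. \<exists>z. (\<lambda>i. if i < n then x i else z i) \<in> S} = S" by (simp add: \<pi>_def[abs_def])
  then show ?case using 0 by simp
next
  case (Suc m)
  \<comment> \<open>Coordinate \<open>n + m\<close> lies beyond the first \<open>n\<close>, so the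
    innermost quantified value is absorbed into \<open>z\<close>.\<close>
  have eq: "(\<lambda>i. if i < n then x i else z i)(n + m := t) = (\<lambda>i. if i < n then x i else (z(n + m := t)) i)" for x z t
    by auto
  have "constructible n {x. \<exists>z. (\<lambda>i. if i < n then x i else z i) \<in> {x. \<exists>t. x(n + m := t) \<in> S}}"
    using Suc.prems by (intro Suc.IH constructible_projection) simp
  also have "{x. \<exists>z. (\<lambda>i. if i < n then x i else z i) \<in> {x. \<exists>t. x(n + m := t) \<in> S}} =
      {x. \<exists>z. (\<lambda>i. if i < n then x i else z i) \<in> S}"
  proof (intro Collect_cong iffI)
    fix x assume "\<exists>z. (\<lambda>i. if i < n then x i else z i) \<in> {x. \<exists>t. x(n + m := t) \<in> S}"
    then show "\<exists>z. (\<lambda>i. if i < n then x i else z i) \<in> S"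
      unfolding mem_Collect_eq eq by (elim exE) (rule exI)
  next
    fix x assume "\<exists>z. (\<lambda>i. if i < n then x i else z i) \<in> S"
    then obtain z where z: "(\<lambda>i. if i < n then x i else z i) \<in> S" ..
    have "(\<lambda>i. if i < n then x i else z i)(n + m := z (n + m)) = (\<lambda>i. if i < n then x i else z i)"
      by auto
    with z show "\<exists>z. (\<lambda>i. if i < n then x i else z i) \<in> {x. \<exists>t. x(n + m := t) \<in> S}"
      unfolding mem_Collect_eq by (intro exI[of _ z] exI[of _ "z (n + m)"]) (simp only:)
  qed
  finally show ?case .
qed

text \<open>The image is a projection of the graph, with the argument stored in the coordinates from
  \<open>K\<close> on.\<close>

lemma polyfun_image_constructible:
  assumes F: "\<And>k. k < K \<Longrightarrow> polyfun M (F k)"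
  shows "constructible K {y. \<exists>x. \<forall>k<K. y k = F k x}"
proof -
  define S where "S = {z. \<forall>k\<in>{..<K}. z k - F k (\<lambda>i. z (K + i)) = 0}"
  have "constructible (K + M) S"
    unfolding S_def
    by (intro constructible_Ball zeros polyfun_diff polyfun_coord polyfun_subst[OF F]) auto
  then have "constructible K {y. \<exists>z. (\<lambda>i. if i < K then y i else z i) \<in> S}"
    by (rule constructible_projection_iterated)
  also have "{y. \<exists>z. (\<lambda>i. if i < K then y i else z i) \<in> S} = {y. \<exists>x. \<forall>k<K. y k = F k x}"
  proof (intro Collect_cong iffI)
    fix y assume "\<exists>z. (\<lambda>i. if i < K then y i else z i) \<in> S"
    then show "\<exists>x. \<forall>k<K. y k = F k x" by (auto simp: S_def)
  next
    fix y assume "\<exists>x. \<forall>k<K. y k = F k x"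
    then obtain x where "\<forall>k<K. y k = F k x" ..
    then have "(\<lambda>i. if i < K then y i else x (i - K)) \<in> S" by (simp add: S_def)
    then show "\<exists>z. (\<lambda>i. if i < K then y i else z i) \<in> S" by (intro exI[of _ "\<lambda>i. x (i - K)"])
  qed
  finally show ?thesis .
qed

section \<open>Lowest-order terms along curves\<close>

text \<open>Along a curve \<open>s \<mapsto> s z(s)\<close> the terms of least degree \<open>m\<close> contribute \<open>s\<^sup>m\<close> times their value
  at \<open>z(0)\<close>, up to higher order, so they vanish at \<open>z(0)\<close> and can be discarded.\<close>
lemma polyfun_eq_0_if_vanishes_on_curves:
  assumes "polyfun n h"
    and curves: "\<And>z0. \<exists>z. (\<forall>k<n. isCont (\<lambda>s. z s k) 0 \<and> z 0 k = z0 k) \<and> (\<forall>s. s \<noteq> 0 \<longrightarrow> h (\<lambda>k. s * z s k) = 0)"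
  shows "h x = 0"
proof -
  obtain E a where E: "finite E" "\<And>x. h x = (\<Sum>e\<in>E. a e * (\<Prod>i<n. x i ^ e i))"
    using assms(1) unfolding polyfun_def by blast
  from E(1) E(2) show ?thesis
  proof (induction "card E" arbitrary: E rule: less_induct)
    case less
    show ?case
    proof (cases "E = {}")
      case True then show ?thesis using less by simp
    next
      case False
      define deg where "deg e = (\<Sum>i<n. e i)" for e :: "nat \<Rightarrow> nat"
      define m where "m = Min (deg ` E)"
      have m_le: "m \<le> deg e" if "e \<in> E" for e using that less.prems(1) by (simp add: m_def)
      define E0 where "E0 = {e \<in> E. deg e = m}"
      have "m \<in> deg ` E" unfolding m_def using less.prems(1) False by (intro Min_in) auto
      then have "E0 \<noteq> {}" by (auto simp: E0_def)
      have "(\<Sum>e\<in>E0. a e * (\<Prod>i<n. z0 i ^ e i)) = 0" for z0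
      proof -
        obtain z where z: "\<And>k. k < n \<Longrightarrow> isCont (\<lambda>s. z s k) 0" "\<And>k. k < n \<Longrightarrow> z 0 k = z0 k"
            "\<And>s. s \<noteq> 0 \<Longrightarrow> h (\<lambda>k. s * z s k) = 0" using curves[of z0] by blast
        \<comment> \<open>\<open>h\<close> along the curve divided by \<open>s ^ m\<close>, extended
          to \<open>s = 0\<close>, where only the terms in \<open>E0\<close> survive. It is zero off
          0 and continuous, hence zero at 0.\<close>
        define G where "G s = (\<Sum>e\<in>E. s ^ (deg e - m) * (a e * (\<Prod>i<n. z s i ^ e i)))" for s
        have "h (\<lambda>k. s * z s k) = s ^ m * G s" for s
        proof -
          have "(\<Prod>i<n. (s * z s i) ^ e i) = s ^ m * s ^ (deg e - m) * (\<Prod>i<n. z s i ^ e i)" if "e \<in> E" for e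
            using m_le[OF that]
            by (simp add: power_mult_distrib prod.distrib deg_def flip: power_sum power_add)
          then show ?thesis unfolding G_def less.prems(2) sum_distrib_left
            by (intro sum.cong) (auto simp: mult_ac)
        qed
        then have G: "G s = 0" if "s \<noteq> 0" for s using z(3)[OF that] that by simp
        have "isCont G 0" unfolding G_def using z(1) by (intro continuous_intros) auto
        then have "(G \<longlongrightarrow> G 0) (at 0)" by (simp add: isCont_def)
        moreover have "(G \<longlongrightarrow> 0) (at 0)"
          using G by (intro tendsto_eventually) (auto simp: eventually_at_filter)
        ultimately have "G 0 = 0" using tendsto_unique[OF at_neq_bot] by blast
        moreover have "G 0 = (\<Sum>e\<in>E0. a e * (\<Prod>i<n. z0 i ^ e i))"
          unfolding G_def
        proof (rule sum.mono_neutral_cong_right)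
          show "\<forall>e\<in>E - E0. 0 ^ (deg e - m) * (a e * (\<Prod>i<n. z 0 i ^ e i)) = 0"
            using m_le by (auto simp: E0_def le_less)
        qed (use less.prems(1) z(2) in \<open>auto simp: E0_def\<close>)
        ultimately show ?thesis by simp
      qed
      moreover have "E0 \<subseteq> E" by (auto simp: E0_def)
      \<comment> \<open>As \<open>z0\<close> was arbitrary, the terms in \<open>E0\<close> sum to
        the zero function; removing them leaves fewer monomials.\<close>
      ultimately have "h x = (\<Sum>e\<in>E - E0. a e * (\<Prod>i<n. x i ^ e i))" for x
        unfolding less.prems(2) using less.prems(1) by (subst sum.subset_diff[of E0 E]) auto
      moreover have "card (E - E0) < card E"
        using less.prems(1) \<open>E0 \<noteq> {}\<close> by (intro psubset_card_mono) (auto simp: E0_def)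
      ultimately show ?thesis using less.hyps[of "E - E0"] less.prems(1) by simp
    qed
  qed
qed

section \<open>Binary forms and spans of multiples of linear powers\<close>

lemma bform_eq_poly:
  assumes "degree p \<le> d" "y \<noteq> 0"
  shows "bform d (coeff p) x y = y ^ d * poly p (x / y)"
proof -
  have "poly p (x / y) = (\<Sum>k\<le>d. coeff p k * (x / y) ^ k)"
    unfolding poly_altdef using assms(1) by (intro sum.mono_neutral_left) (auto simp: coeff_eq_0)
  also have "y ^ d * \<dots> = bform d (coeff p) x y"
    unfolding bform_def sum_distrib_left
  proof (intro sum.cong refl)
    fix k assume "k \<in> {..d}"
    then have "y ^ d = y ^ k * y ^ (d - k)" by (simp flip: power_add)
    then show "y ^ d * (coeff p k * (x / y) ^ k) = coeff p k * x ^ k * y ^ (d - k)"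
      using assms(2) by (simp add: field_simps)
  qed
  finally show ?thesis ..
qed

lemma bform_0_right: "bform d c x 0 = c d * x ^ d"
proof -
  have "bform d c x 0 = (\<Sum>k\<in>{d}. c k * x ^ k)"
    unfolding bform_def by (intro sum.mono_neutral_cong_right) (auto simp: power_0_left)
  then show ?thesis by simp
qed

lemma coeff_mult_degree_bound:
  fixes p q :: "complex poly"
  assumes "degree p \<le> d" "degree q \<le> e"
  shows "coeff (p * q) (d + e) = coeff p d * coeff q e"
proof (cases "degree p = d \<and> degree q = e")
  case True then show ?thesis using coeff_mult_degree_sum[of p q] by simp
next
  case False
  then have "degree (p * q) < d + e" "degree p < d \<or> degree q < e"
    using assms degree_mult_le[of p q] by linarith+
  then show ?thesis by (auto simp: coeff_eq_0)
qed

text \<open>For \<open>y\<close> nonzero this is multiplicativity of evaluation at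
  \<open>x / y\<close>; for \<open>y = 0\<close> a form retains only its coefficient at the degree
  bound, which is multiplicative too.\<close>

lemma bform_mult:
  assumes "degree p \<le> d" "degree q \<le> e"
  shows "bform (d + e) (coeff (p * q)) x y = bform d (coeff p) x y * bform e (coeff q) x y"
proof (cases "y = 0")
  case True
  then show ?thesis using assms by (simp add: bform_0_right coeff_mult_degree_bound power_add)
next
  case False
  have "degree (p * q) \<le> d + e" using degree_mult_le[of p q] assms by linarith
  with False assms show ?thesis by (simp add: bform_eq_poly power_add)
qed

lemma bform_power:
  assumes "degree p \<le> d"
  shows "bform (d * n) (coeff (p ^ n)) x y = bform d (coeff p) x y ^ n"
proof (induction n)
  case 0 then show ?case by (simp add: bform_def)
next
  case (Suc n)
  have "degree (p ^ n) \<le> d * n"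
    using degree_power_le[of p n] mult_le_mono1[OF assms, of n] by linarith
  then show ?case using bform_mult[OF assms, of "p ^ n" "d * n"] Suc by simp
qed

lemma bform_sum: "bform d (coeff (\<Sum>i\<in>I. p i)) x y = (\<Sum>i\<in>I. bform d (coeff (p i)) x y)"
  by (simp add: bform_def coeff_sum sum_distrib_right sum.swap[of _ I])

lemma isCont_coeff_mult:
  fixes A B :: "complex \<Rightarrow> complex poly"
  assumes "\<And>k. isCont (\<lambda>s. coeff (A s) k) t" "\<And>k. isCont (\<lambda>s. coeff (B s) k) t"
  shows "isCont (\<lambda>s. coeff (A s * B s) k) t"
  unfolding coeff_mult by (intro continuous_intros assms)

lemma isCont_coeff_power:
  fixes A :: "complex \<Rightarrow> complex poly"
  assumes "\<And>k. isCont (\<lambda>s. coeff (A s) k) t"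
  shows "isCont (\<lambda>s. coeff (A s ^ n) k) t"
proof (induction n arbitrary: k)
  case (Suc n)
  then show ?case unfolding power_Suc by (intro isCont_coeff_mult assms)
qed simp

section \<open>Spanning by multiples of powers of linear forms\<close>

lemma smult_sum_right: "smult a (\<Sum>i\<in>I. f i) = (\<Sum>i\<in>I. smult a (f i))"
  by (induction I rule: infinite_finite_induct) (auto simp: smult_add_right)

text \<open>Matching the values at \<open>c\<close> leaves a remainder divisible by
  \<open>X - c\<close>. Repeated use expands \<open>q\<close> in a triangular family with one
  \<open>e\<close> for each degree.\<close>

lemma poly_split_at:
  fixes q e :: "complex poly"
  assumes "degree q \<le> Suc j" "degree e \<le> Suc j" "poly e c \<noteq> 0"
  shows "\<exists>\<alpha> r. q = smult \<alpha> e + [:- c, 1:] * r \<and> degree r \<le> j"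
proof -
  define \<alpha> where "\<alpha> = poly q c / poly e c"
  have "poly (q - smult \<alpha> e) c = 0" using assms(3) by (simp add: \<alpha>_def)
  then obtain r where r: "q - smult \<alpha> e = [:- c, 1:] * r"
    unfolding poly_eq_0_iff_dvd by (elim dvdE)
  have "degree ([:- c, 1:] * r) \<le> Suc j"
    unfolding r[symmetric] using assms(1,2) by (intro degree_diff_le) (auto intro: order.trans[OF degree_smult_le])
  then have "degree r \<le> j" by (cases "r = 0") (auto simp: degree_mult_eq simp del: mult_pCons_left)
  moreover have "q = smult \<alpha> e + [:- c, 1:] * r" using r by (simp add: algebra_simps)
  ultimately show ?thesis by blast
qed

text \<open>Determines the kernel of the derivation used for spanning. For \<open>n > 0\<close>
  evaluation at \<open>c\<close> gives a root, and cancelling \<open>X - c\<close> yields the same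
  equation for the cofactor with \<open>n\<close> lowered by one.\<close>

lemma eq_smult_linear_power_if_pderiv:
  fixes r :: "complex poly"
  assumes "smult (of_nat n) r = [:- c, 1:] * pderiv r"
  shows "\<exists>\<alpha>. r = smult \<alpha> ([:- c, 1:] ^ n)"
  using assms
proof (induction n arbitrary: r)
  case 0
  then have "pderiv r = 0" by (simp del: mult_pCons_left)
  then show ?case by (auto simp: pderiv_eq_0_iff elim!: degree_eq_zeroE)
next
  case (Suc n)
  have "poly (smult (of_nat (Suc n)) r) c = 0" unfolding Suc.prems by simp
  then have "poly r c = 0" by (simp del: of_nat_Suc)
  then obtain s where s: "r = [:- c, 1:] * s" unfolding poly_eq_0_iff_dvd by (elim dvdE)
  have "pderiv r = s + [:- c, 1:] * pderiv s"
    unfolding s pderiv_mult by (simp add: pderiv_pCons del: mult_pCons_left)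
  then have "[:- c, 1:] * smult (of_nat (Suc n)) s = [:- c, 1:] * (s + [:- c, 1:] * pderiv s)"
    using Suc.prems unfolding s mult_smult_right by simp
  then have "smult (of_nat (Suc n)) s = s + [:- c, 1:] * pderiv s"
    by (subst (asm) mult_left_cancel) simp_all
  then have "smult (of_nat n) s = [:- c, 1:] * pderiv s" by (simp add: smult_add_left)
  then obtain \<alpha> where "s = smult \<alpha> ([:- c, 1:] ^ n)" using Suc.IH by blast
  then show ?case by (intro exI[of _ \<alpha>]) (simp add: s)
qed

text \<open>The derivation \<open>T p = (D + 1) p - (X - c\<^sub>0) p'\<close>, which in homogeneous coordinates is
  differentiation along the zero line of \<open>X - c\<^sub>0 Y\<close>, maps forms of degree \<open>D + 1\<close> to forms of
  degree \<open>D\<close> and kills only the multiples of \<open>(X - c\<^sub>0)\<^sup>D\<^sup>+\<^sup>1\<close>.  It lowers the multiplicity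
  \<open>m c\<^sub>0\<close> by one and keeps the others.\<close>
lemma multiples_of_linear_powers_span:
  fixes W :: "complex poly set" and m :: "complex \<Rightarrow> nat"
  assumes "finite C" "D < (\<Sum>c\<in>C. m c)"
    and add: "\<And>p q. p \<in> W \<Longrightarrow> q \<in> W \<Longrightarrow> p + q \<in> W"
    and smult: "\<And>a p. p \<in> W \<Longrightarrow> smult a p \<in> W"
    and gen: "\<And>c j q. c \<in> C \<Longrightarrow> j < m c \<Longrightarrow> j \<le> D \<Longrightarrow> degree q \<le> j \<Longrightarrow> [:- c, 1:] ^ (D - j) * q \<in> W"
    and "degree p \<le> D"
  shows "p \<in> W"
  using assms(2-)
\<comment> \<open>\<open>m\<close> and \<open>W\<close> vary because the induction hypothesis is
  applied to the image of \<open>W\<close> under \<open>T\<close>, with the multiplicity at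
  \<open>c0\<close> lowered.\<close>
proof (induction D arbitrary: m W p)
  case 0
  then obtain c where "c \<in> C" "0 < m c" by (metis less_not_refl2 gr0I sum.neutral)
  then show ?case using "0.prems"(4)[of c 0 p] "0.prems"(5) by simp
next
  case (Suc D)
  note add = Suc.prems(2) and smult = Suc.prems(3) and gen = Suc.prems(4)
  obtain c0 where c0: "c0 \<in> C" "0 < m c0" using Suc.prems(1) by (metis less_nat_zero_code gr0I sum.neutral)
  define M where "M = [:- c0, 1:]"
  define T where "T p = smult (of_nat (Suc D)) p - M * pderiv p" for p
  define m' where "m' = m(c0 := m c0 - 1)"
  have T_add: "T (p + q) = T p + T q" for p q by (simp add: T_def pderiv_add smult_add_right algebra_simps)
  have T_smult: "T (smult a p) = smult a (T p)" for a p
    by (simp add: T_def pderiv_smult smult_diff_right mult.commute)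
  have add': "p + q \<in> T ` W" if "p \<in> T ` W" "q \<in> T ` W" for p q
    using that add by (auto simp flip: T_add)
  have smult': "smult a p \<in> T ` W" if "p \<in> T ` W" for a p
    using that smult by (auto simp flip: T_smult)
  have smult_cancel: "p \<in> T ` W" if "smult a p \<in> T ` W" "a \<noteq> 0" for a p
    using smult'[OF that(1), of "inverse a"] that(2) by simp
  have pderiv_linear_power: "pderiv ([:- c, 1:] ^ Suc a) = smult (of_nat (Suc a)) ([:- c, 1:] ^ a)" for a and c :: complex
    by (simp add: pderiv_power_Suc pderiv_pCons del: power_Suc)
  \<comment> \<open>\<open>T\<close> treats \<open>M\<close> as a constant, since \<open>M\<close>
    vanishes along the direction of differentiation; \<open>X - c\<close> is sent to the scalar
    \<open>c0 - c\<close>.\<close>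
  have T_product: "T ([:- c, 1:] ^ Suc a * M ^ b) = smult (of_nat (Suc a) * (c0 - c)) ([:- c, 1:] ^ a * M ^ b)"
    if "a + b = D" for a b c
  proof (cases b)
    case 0
    have "poly (T ([:- c, 1:] ^ Suc a * M ^ b)) t =
        of_nat (Suc D) * (t - c) ^ Suc a - (t - c0) * (of_nat (Suc a) * (t - c) ^ a)" for t
      by (simp add: T_def M_def 0 pderiv_linear_power algebra_simps del: power_Suc of_nat_Suc)
    then show ?thesis using that 0 unfolding poly_eq_poly_eq_iff[symmetric]
      by (simp add: fun_eq_iff algebra_simps)
  next
    case (Suc b')
    have "poly (T ([:- c, 1:] ^ Suc a * M ^ b)) t = of_nat (Suc D) * ((t - c) ^ Suc a * (t - c0) ^ b) -
        (t - c0) * ((t - c) ^ Suc a * (of_nat b * (t - c0) ^ b') + (t - c0) ^ b * (of_nat (Suc a) * (t - c) ^ a))" for t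
      by (simp add: T_def M_def Suc pderiv_mult pderiv_linear_power del: power_Suc of_nat_Suc mult_pCons_left mult_pCons_right)
    moreover have "of_nat (Suc D) * ((t - c) ^ Suc a * (t - c0) ^ b) -
        (t - c0) * ((t - c) ^ Suc a * (of_nat b * (t - c0) ^ b') + (t - c0) ^ b * (of_nat (Suc a) * (t - c) ^ a)) =
        of_nat (Suc a) * (c0 - c) * ((t - c) ^ a * (t - c0) ^ b)" for t
      using that Suc by (auto simp: algebra_simps)
    ultimately show ?thesis unfolding poly_eq_poly_eq_iff[symmetric] fun_eq_iff
      by (simp add: M_def del: power_Suc of_nat_Suc mult_pCons_left mult_pCons_right)
  qed
  \<comment> \<open>As a form of degree \<open>D + 1\<close> the argument is
    \<open>M ^ (D - j) * Y ^ (j + 1)\<close>, and the derivation sends \<open>Y\<close> to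
    1.\<close>
  have T_power: "T (M ^ (D - j)) = smult (of_nat (Suc j)) (M ^ (D - j))" if "j \<le> D" for j
  proof (cases "D - j")
    case 0
    then show ?thesis using that by (simp add: T_def)
  next
    case (Suc a)
    then have D: "D = Suc a + j" using that by simp
    have "T (M ^ Suc a) = smult (of_nat (Suc D)) (M ^ Suc a) - smult (of_nat (Suc a)) (M ^ Suc a)"
      unfolding T_def pderiv_linear_power[of c0 a, folded M_def] by simp
    also have "\<dots> = smult (of_nat (Suc j)) (M ^ Suc a)" unfolding D by (simp flip: smult_diff_left)
    finally show ?thesis unfolding Suc .
  qed
  have gen': "[:- c, 1:] ^ (D - j) * q \<in> T ` W" if "c \<in> C" "j < m' c" "j \<le> D" "degree q \<le> j" for c j q
  proof -
    \<comment> \<open>The products \<open>(X - c) ^ (D - j) * e j\<close> are to form a triangular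
      family, which needs \<open>e j\<close> nonzero at \<open>c\<close>. \<open>M ^ j\<close>
      qualifies unless \<open>c = c0\<close>, where 1 is used.\<close>
    define e where "e j = (if c = c0 then 1 else M ^ j)" for j :: nat
    have deg_e: "degree (e j) \<le> j" for j
      by (simp add: e_def M_def degree_linear_power)
    have e_nz: "poly (e j) c \<noteq> 0" for j by (simp add: e_def M_def)
    have e_in: "[:- c, 1:] ^ (D - j) * e j \<in> T ` W" if "j < m' c" "j \<le> D" for j
    proof (cases "c = c0")
      case True
      \<comment> \<open>\<open>T\<close> does not lower the power of \<open>M\<close>, so at
        \<open>c0\<close> the index shifts to \<open>Suc j\<close>, which is allowed because
        \<open>m' c0\<close> is \<open>m c0 - 1\<close>.\<close>
      have "[:- c, 1:] ^ (Suc D - Suc j) * 1 \<in> W"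
        using that True by (intro gen \<open>c \<in> C\<close>) (auto simp: m'_def)
      then have "T (M ^ (D - j)) \<in> T ` W" by (simp add: True M_def)
      then have "smult (of_nat (Suc j)) (M ^ (D - j)) \<in> T ` W" unfolding T_power[OF that(2)] .
      then have "M ^ (D - j) \<in> T ` W" by (rule smult_cancel) (simp del: of_nat_Suc)
      then show ?thesis by (simp add: e_def True M_def)
    next
      case False
      have "[:- c, 1:] ^ (Suc D - j) * M ^ j \<in> W"
        using that False by (intro gen \<open>c \<in> C\<close>) (auto simp: m'_def M_def degree_linear_power)
      then have "T ([:- c, 1:] ^ Suc (D - j) * M ^ j) \<in> T ` W" by (simp only: Suc_diff_le[OF that(2)] imageI)
      then have "smult (of_nat (Suc (D - j)) * (c0 - c)) ([:- c, 1:] ^ (D - j) * M ^ j) \<in> T ` W"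
        using T_product[of "D - j" j c] that(2) by simp
      then have "[:- c, 1:] ^ (D - j) * M ^ j \<in> T ` W"
        by (rule smult_cancel) (use False in \<open>simp del: of_nat_Suc\<close>)
      then show ?thesis by (simp add: e_def False)
    qed
    \<comment> \<open>Expansion in the triangular family: split off a multiple of \<open>e j\<close>
      and move a factor \<open>X - c\<close> from the cofactor into the power.\<close>
    show ?thesis using that(2-)
    proof (induction j arbitrary: q)
      case 0
      then obtain a where "q = [:a:]" by (auto elim!: degree_eq_zeroE)
      then have "[:- c, 1:] ^ (D - 0) * q = smult a ([:- c, 1:] ^ (D - 0) * e 0)" by (simp add: e_def)
      then show ?case using smult'[OF e_in[of 0]] 0 by simp
    next
      case (Suc j)
      obtain a r where q: "q = smult a (e (Suc j)) + [:- c, 1:] * r" and r: "degree r \<le> j"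
        using poly_split_at[OF Suc.prems(3) deg_e e_nz] by blast
      have "[:- c, 1:] ^ (D - j) * r \<in> T ` W" using Suc.prems r by (intro Suc.IH) auto
      moreover have "smult a ([:- c, 1:] ^ (D - Suc j) * e (Suc j)) \<in> T ` W"
        using Suc.prems by (intro smult' e_in) auto
      moreover have "[:- c, 1:] ^ (D - j) = [:- c, 1:] * [:- c, 1:] ^ (D - Suc j)"
        using Suc.prems(2) by (metis Suc_diff_Suc Suc_le_lessD power_Suc)
      then have "[:- c, 1:] ^ (D - Suc j) * q =
          smult a ([:- c, 1:] ^ (D - Suc j) * e (Suc j)) + [:- c, 1:] ^ (D - j) * r"
        unfolding q by (simp add: distrib_left mult_ac del: mult_pCons_left mult_pCons_right)
      ultimately show ?case using add' by presburger
    qed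
  qed
  have "(\<Sum>c\<in>C. m c) = m c0 + (\<Sum>c\<in>C - {c0}. m c)" "(\<Sum>c\<in>C. m' c) = m' c0 + (\<Sum>c\<in>C - {c0}. m' c)"
    using \<open>finite C\<close> c0(1) by (auto intro: sum.remove)
  moreover have "(\<Sum>c\<in>C - {c0}. m' c) = (\<Sum>c\<in>C - {c0}. m c)" by (auto simp: m'_def intro: sum.cong)
  ultimately have sum_m': "D < (\<Sum>c\<in>C. m' c)" using Suc.prems(1) c0(2) by (simp add: m'_def)
  have deg_T: "degree (T p) \<le> D"
  proof (rule degree_le, intro allI impI)
    fix i assume "D < i"
    then obtain i' where i: "i = Suc i'" "D \<le> i'" by (cases i) auto
    have "coeff p (Suc (Suc i')) = 0" using Suc.prems(5) i by (intro coeff_eq_0) simp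
    moreover have "i' = D \<or> coeff p (Suc i') = 0" using Suc.prems(5) i by (auto intro!: coeff_eq_0)
    ultimately show "coeff (T p) i = 0" by (auto simp: T_def M_def i coeff_pderiv)
  qed
  have "T p \<in> T ` W" by (rule Suc.IH[OF sum_m' add' smult' gen' deg_T])
  then obtain w where w: "w \<in> W" "T p = T w" by blast
  \<comment> \<open>The difference of \<open>p\<close> and \<open>w\<close> is in the kernel of
    \<open>T\<close>, hence a multiple of \<open>M ^ Suc D\<close>, which is itself a generator
    since \<open>m c0 > 0\<close>.\<close>
  have "T (p + smult (-1) w) = 0" unfolding T_add T_smult w(2) by simp
  then obtain a where a: "p + smult (-1) w = smult a (M ^ Suc D)"
    using eq_smult_linear_power_if_pderiv[of "Suc D" "p + smult (-1) w" c0] by (auto simp: T_def M_def)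
  have "M ^ Suc D \<in> W" using gen[of c0 0 1] c0 by (simp add: M_def)
  then have "smult a (M ^ Suc D) + w \<in> W" using add smult w(1) by blast
  then show ?case unfolding a[symmetric] by simp
qed

text \<open>The points \<open>0, ..., N - 1\<close> serve as \<open>N\<close> distinct ones; with
  multiplicity \<open>u + 1\<close> at each, the total exceeds \<open>D\<close>.\<close>

lemma linear_power_combinations:
  fixes p :: "complex poly"
  assumes "u \<le> D" "D < N * Suc u" "degree p \<le> D"
  shows "\<exists>q. (\<forall>i<N. degree (q i) \<le> u) \<and> p = (\<Sum>i<N. [:- of_nat i, 1:] ^ (D - u) * q i)"
proof -
  define comb where "comb q = (\<Sum>i<N. [:- of_nat i, 1:] ^ (D - u) * q i)" for q :: "nat \<Rightarrow> complex poly"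
  define W where "W = comb ` {q. \<forall>i<N. degree (q i) \<le> u}"
  have "p \<in> W"
  proof (rule multiples_of_linear_powers_span[where C = "of_nat ` {..<N}" and m = "\<lambda>_. Suc u" and D = D])
    show "D < (\<Sum>c\<in>(of_nat ` {..<N} :: complex set). Suc u)"
      using assms(2) by (simp add: card_image inj_on_def)
  next
    fix p q assume "p \<in> W" "q \<in> W"
    then obtain f g where "\<forall>i<N. degree (f i) \<le> u" "p = comb f" "\<forall>i<N. degree (g i) \<le> u" "q = comb g"
      by (auto simp: W_def)
    then show "p + q \<in> W" unfolding W_def
      by (intro image_eqI[of _ _ "\<lambda>i. f i + g i"]) (auto simp: comb_def distrib_left sum.distrib intro: degree_add_le)
  next
    fix a p assume "p \<in> W"
    then obtain f where "\<forall>i<N. degree (f i) \<le> u" "p = comb f" by (auto simp: W_def)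
    then show "smult a p \<in> W" unfolding W_def
      by (intro image_eqI[of _ _ "\<lambda>i. smult a (f i)"])
        (auto simp: comb_def smult_sum_right intro: order.trans[OF degree_smult_le])
  next
    fix c :: complex and j and q :: "complex poly" assume c: "c \<in> of_nat ` {..<N}" and j: "j < Suc u" "degree q \<le> j"
    obtain i where i: "i < N" "c = of_nat i" using c by auto
    \<comment> \<open>A generator with \<open>j < u\<close> is covered by exponent
      \<open>D - u\<close>: the surplus power of \<open>X - c\<close> goes into the
      cofactor.\<close>
    define r where "r = [:- c, 1:] ^ (u - j) * q"
    have "degree r \<le> u"
      using degree_mult_le[of "[:- c, 1:] ^ (u - j)" q] j by (simp add: r_def degree_linear_power)
    moreover have "[:- c, 1:] ^ (D - j) * q = comb (\<lambda>k. if k = i then r else 0)"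
    proof -
      have "D - j = (D - u) + (u - j)" using assms(1) j by simp
      then have "[:- c, 1:] ^ (D - j) * q = [:- of_nat i, 1:] ^ (D - u) * r"
        by (simp only: r_def i(2) power_add mult.assoc)
      then show ?thesis using i(1) by (simp add: comb_def if_distrib cong: if_cong)
    qed
    ultimately show "[:- c, 1:] ^ (D - j) * q \<in> W" unfolding W_def
      by (intro image_eqI[of _ _ "\<lambda>k. if k = i then r else 0"]) auto
  qed (use assms in auto)
  then show ?thesis by (auto simp: W_def comb_def)
qed

section \<open>Power sums and the generic form\<close>

text \<open>The derivative of \<open>(f\<^sub>i) \<mapsto> \<Sum> f\<^sub>i\<^sup>v\<close> at \<open>f\<^sub>i = (X - i)\<^sup>u\<close> is
  \<open>(w\<^sub>i) \<mapsto> v \<Sum> (X - i)\<^sup>u\<^sup>(\<^sup>v\<^sup>-\<^sup>1\<^sup>) w\<^sub>i\<close>, which is onto.\<close>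
lemma polyfun_eq_0_on_power_sums:
  assumes g: "polyfun (Suc (u * v)) g" and "v \<ge> 1" "u * v < N * Suc u"
    and vanish: "\<And>f. \<forall>i<N. degree (f i) \<le> u \<Longrightarrow> g (coeff (\<Sum>i<N. f i ^ v)) = 0"
  shows "g y = 0"
proof -
  define D where "D = u * v"
  obtain n where v: "v = Suc n" using assms(2) by (cases v) auto
  define L :: "nat \<Rightarrow> complex poly" where "L i = [:- of_nat i, 1:] ^ u" for i
  have deg_L: "degree (L i) \<le> u" for i by (simp add: L_def degree_linear_power)
  define b where "b = coeff (\<Sum>i<N. L i ^ v)"
  \<comment> \<open>Translation moves the image point \<open>b\<close> to the origin, where the
    criterion along curves applies.\<close>
  define h where "h z = g (\<lambda>k. b k + z k)" for z
  have "h z = 0" for z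
  proof (rule polyfun_eq_0_if_vanishes_on_curves[of "Suc D" h])
    show "polyfun (Suc D) h"
      unfolding h_def D_def by (intro polyfun_subst[OF g] polyfun_add polyfun_const polyfun_coord)
    fix z0 :: "nat \<Rightarrow> complex"
    define p where "p = (\<Sum>k\<le>D. monom (z0 k) k)"
    have "degree p \<le> D"
      unfolding p_def by (intro degree_sum_le) (auto intro: order.trans[OF degree_monom_le])
    then obtain q where q: "\<forall>i<N. degree (q i) \<le> u" "p = (\<Sum>i<N. [:- of_nat i, 1:] ^ (D - u) * q i)"
      using linear_power_combinations[of u D N p] assms(2,3) by (auto simp: D_def)
    \<comment> \<open>\<open>1 / v\<close> cancels the factor \<open>v\<close> of the derivative, so
      the derivative in the direction \<open>w\<close> is \<open>p\<close>, whose coefficients are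
      \<open>z0\<close>.\<close>
    define w where "w i = smult (1 / of_nat v) (q i)" for i
    \<comment> \<open>Difference quotient of the power sum in the direction \<open>w\<close>,
      written through the factorisation of \<open>a ^ v - b ^ v\<close> so that it also makes sense
      at \<open>s = 0\<close>, where it is the derivative.\<close>
    define z where "z s = coeff (\<Sum>i<N. w i * (\<Sum>j<v. (L i + smult s (w i)) ^ j * L i ^ (n - j)))" for s
    show "\<exists>z. (\<forall>k<Suc D. isCont (\<lambda>s. z s k) 0 \<and> z 0 k = z0 k) \<and> (\<forall>s. s \<noteq> 0 \<longrightarrow> h (\<lambda>k. s * z s k) = 0)"
    proof (intro exI[of _ z] conjI allI impI)
      fix k assume "k < Suc D"
      show "isCont (\<lambda>s. z s k) 0"
        unfolding z_def coeff_sum sum_distrib_left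
        by (intro continuous_intros isCont_coeff_mult isCont_coeff_power)
          (auto intro!: continuous_intros)
      have "w i * (\<Sum>j<v. L i ^ j * L i ^ (n - j)) = [:- of_nat i, 1:] ^ (D - u) * q i" for i
      proof -
        have "(\<Sum>j<v. L i ^ j * L i ^ (n - j)) = (\<Sum>j<v. L i ^ n)"
          by (intro sum.cong) (auto simp: v simp flip: power_add)
        also have "\<dots> = smult (of_nat v) (L i ^ n)"
          by (simp add: of_nat_poly)
        finally show ?thesis
          by (simp add: w_def v L_def D_def mult.commute del: of_nat_Suc flip: power_mult)
      qed
      then have "z 0 = coeff p" by (simp add: z_def q(2))
      then show "z 0 k = z0 k" using \<open>k < Suc D\<close> by (simp add: p_def coeff_sum)
    next
      fix s :: complex
      have "(\<lambda>k. b k + s * z s k) = coeff (\<Sum>i<N. (L i + smult s (w i)) ^ v)"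
      proof -
        have "smult s (w i * (\<Sum>j<v. (L i + smult s (w i)) ^ j * L i ^ (n - j)))
            = (L i + smult s (w i)) ^ v - L i ^ v" for i
          unfolding v by (subst diff_power_eq_sum) simp
        then have "(\<Sum>i<N. L i ^ v) + smult s (\<Sum>i<N. w i * (\<Sum>j<v. (L i + smult s (w i)) ^ j * L i ^ (n - j)))
            = (\<Sum>i<N. (L i + smult s (w i)) ^ v)"
          by (simp add: smult_sum_right sum_subtractf)
        from this[symmetric] show ?thesis by (simp add: b_def z_def fun_eq_iff)
      qed
      moreover have "\<forall>i<N. degree (L i + smult s (w i)) \<le> u"
        using deg_L q(1) by (auto simp: w_def intro!: degree_add_le order.trans[OF degree_smult_le])
      ultimately show "h (\<lambda>k. s * z s k) = 0" unfolding h_def using vanish by simp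
    qed
  qed
  from this[of "\<lambda>k. y k - b k"] show ?thesis by (simp add: h_def)
qed

theorem theorem1p8:
  fixes u v :: nat
  assumes "u \<ge> 1" and "v \<ge> 1"
  shows "\<exists>U. zariski_open (u * v + 1) U \<and> U \<noteq> {} \<and>
    (\<forall>p\<in>U. \<exists>f :: nat \<Rightarrow> nat \<Rightarrow> complex.
       (\<forall>i < nat \<lceil>real (u * v + 1) / real (u + 1)\<rceil>. f i \<in> cspace (u + 1)) \<and>
       (\<forall>x y. bform (u * v) p x y =
          (\<Sum>i < nat \<lceil>real (u * v + 1) / real (u + 1)\<rceil>. (bform u (f i) x y) ^ v)))"
proof -
  define N where "N = nat \<lceil>real (u * v + 1) / real (u + 1)\<rceil>"
  define K where "K = u * v + 1"
  \<comment> \<open>\<open>x\<close> holds the coefficients of \<open>N\<close> polynomials of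
    degree at most \<open>u\<close>, in consecutive blocks of length \<open>u + 1\<close>.\<close>
  define P where "P i x = (\<Sum>j\<le>u. monom (x (i * Suc u + j)) j)" for i and x :: "nat \<Rightarrow> complex"
  define F where "F k x = coeff (\<Sum>i<N. P i x ^ v) k" for k x
  have N: "u * v < N * Suc u"
  proof -
    have "real (u * v + 1) / real (u + 1) \<le> real N" unfolding N_def by linarith
    then have "real (u * v + 1) \<le> real (N * Suc u)" by (simp add: field_simps)
    then show ?thesis by linarith
  qed
  have P_param: "param_poly (N * Suc u) u (P i)" if "i < N" for i
    unfolding P_def
  proof (intro param_poly_sum param_poly_monom polyfun_coord)
    fix j assume "j \<in> {..u}"
    then have "i * Suc u + j < Suc i * Suc u" by simp
    also have "\<dots> \<le> N * Suc u" using that by (intro mult_le_mono1) simp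
    finally show "i * Suc u + j < N * Suc u" .
  qed auto
  have "param_poly (N * Suc u) (u * v) (\<lambda>x. \<Sum>i<N. P i x ^ v)"
    by (intro param_poly_sum param_poly_power P_param) simp
  then have "polyfun (N * Suc u) (F k)" for k
    unfolding F_def by (rule param_poly_coeff)
  then have "constructible K {y. \<exists>x. \<forall>k<K. y k = F k x}" by (rule polyfun_image_constructible)
  from constructible_generic_dichotomy[OF this] obtain g a where g: "polyfun K g" "g a \<noteq> 0"
      "(\<forall>y. g y \<noteq> 0 \<longrightarrow> (\<exists>x. \<forall>k<K. y k = F k x)) \<or> (\<forall>y. g y \<noteq> 0 \<longrightarrow> \<not> (\<exists>x. \<forall>k<K. y k = F k x))"
    by (elim exE conjE) (rule that; simp only: mem_Collect_eq)
  have "\<not> (\<forall>y. g y \<noteq> 0 \<longrightarrow> \<not> (\<exists>x. \<forall>k<K. y k = F k x))"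
  proof
    assume *: "\<forall>y. g y \<noteq> 0 \<longrightarrow> \<not> (\<exists>x. \<forall>k<K. y k = F k x)"
    have "g a = 0"
    proof (rule polyfun_eq_0_on_power_sums[OF _ assms(2) N, of g])
      show "polyfun (Suc (u * v)) g" using g(1) by (simp add: K_def)
      fix f :: "nat \<Rightarrow> complex poly" assume f: "\<forall>i<N. degree (f i) \<le> u"
      \<comment> \<open>The block encoding read backwards, so every tuple of polynomials occurs as a
        parameter.\<close>
      define x where "x n = coeff (f (n div Suc u)) (n mod Suc u)" for n
      have "P i x = f i" if "i < N" for i
      proof -
        have "P i x = (\<Sum>j\<le>u. monom (coeff (f i) j) j)"
          unfolding P_def x_def
        proof (intro sum.cong refl)
          fix j assume "j \<in> {..u}"
          then have "(i * Suc u + j) div Suc u = i" "(i * Suc u + j) mod Suc u = j"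
            by (auto simp only: div_mult_self3 mod_mult_self3 div_less mod_less less_Suc_eq_le atMost_iff)
          then show "monom (coeff (f ((i * Suc u + j) div Suc u)) ((i * Suc u + j) mod Suc u)) j =
              monom (coeff (f i) j) j" by simp
        qed
        then show ?thesis using f that by (simp add: poly_as_sum_of_monoms')
      qed
      then have "coeff (\<Sum>i<N. f i ^ v) k = F k x" for k by (simp add: F_def)
      then show "g (coeff (\<Sum>i<N. f i ^ v)) = 0" using * by blast
    qed
    with g(2) show False ..
  qed
  with g(3) have image: "\<And>y. g y \<noteq> 0 \<Longrightarrow> \<exists>x. \<forall>k<K. y k = F k x" by blast
  define U where "U = {y \<in> cspace K. \<exists>g'\<in>{g}. g' y \<noteq> 0}"
  have "zariski_open K U"
    unfolding zariski_open_def U_def using g(1) by (intro exI[of _ "{g}"]) simp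
  moreover have "U \<noteq> {}"
  proof -
    \<comment> \<open>\<open>a\<close> may have nonzero entries from \<open>K\<close> on; cutting
      them off leaves the value of \<open>g\<close> unchanged and lands in
      \<open>cspace K\<close>.\<close>
    define a' where "a' k = (if k < K then a k else 0)" for k
    have "g a' = g a" by (rule polyfun_cong[OF g(1)]) (simp add: a'_def)
    then have "a' \<in> U" using g(2) by (simp add: U_def cspace_def a'_def)
    then show ?thesis by blast
  qed
  moreover have "\<exists>f :: nat \<Rightarrow> nat \<Rightarrow> complex. (\<forall>i<N. f i \<in> cspace (u + 1)) \<and>
      (\<forall>x y. bform (u * v) p x y = (\<Sum>i<N. bform u (f i) x y ^ v))" if p: "p \<in> U" for p
  proof -
    obtain x where x: "\<forall>k<K. p k = F k x" using image[of p] p by (auto simp: U_def)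
    have deg: "degree (P i x) \<le> u" if "i < N" for i using param_poly_degree[OF P_param[OF that]] .
    have "bform (u * v) p s t = (\<Sum>i<N. bform u (coeff (P i x)) s t ^ v)" for s t
    proof -
      have "bform (u * v) p s t = bform (u * v) (coeff (\<Sum>i<N. P i x ^ v)) s t"
        unfolding bform_def using x by (intro sum.cong refl) (simp add: F_def K_def)
      also have "\<dots> = (\<Sum>i<N. bform u (coeff (P i x)) s t ^ v)"
        unfolding bform_sum by (intro sum.cong refl bform_power deg) simp
      finally show ?thesis .
    qed
    moreover have "\<forall>i<N. coeff (P i x) \<in> cspace (u + 1)"
      using deg by (force simp: cspace_def intro: coeff_eq_0)
    ultimately show ?thesis by (intro exI[of _ "\<lambda>i. coeff (P i x)"]) simp
  qed
  ultimately show ?thesis unfolding K_def N_def by (intro exI[of _ U]) simp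
qed

end
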